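(* Let $F$ be a finite Borel measure on $\mathbb{R}$, identified with its bounded, non-decreasing, right-continuous distribution function $F(x)=F((-\infty,x])$. Let $M(s)=\int_{\mathbb{R}} e^{sx}\,dF(x)$, and define $q^*,r^*$ by $-q^*=\inf\{s\in\mathbb{R}:M(s)<\infty\}$ and $r^*=\sup\{s\in\mathbb{R}:M(s)<\infty\}$. Assume $q^*,r^*\in(0,\infty)$. (i) If for some integer $n\ge 0$, some $\rho>0$ and some $l_1\in R_0$ one has $(-1)^nM^{(n)}(-q^*+s)\sim s^{-\rho}\,l_1(1/s)$ as $s\to0+$, then $$\log F((-\infty,-x])\sim -q^* x\quad\text{as }x\to\infty .$$ (ii) If for some integer $n\ge 0$, some $\rho>0$ and some $l_1\in R_0$ one has $M^{(n)}(r^*-s)\sim s^{-\rho}\,l_1(1/s)$ as $s\to0+$, then $$\log F((x,\infty))\sim -r^* x\quad\text{as }x\to\infty .$$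
   Context: $R_0$ denotes the class of functions slowly varying at infinity: positive measurable functions $l$, defined on a neighbourhood of $+\infty$, with $l(\lambda x)/l(x)\to1$ as $x\to\infty$ for every $\lambda>0$. $M^{(n)}$ is the $n$-th derivative of $M$ ($M^{(0)}=M$), which exists on the open interval $(-q^*,r^* )$. $g\sim h$ means that the ratio $g/h$ tends to $1$ in the indicated limit. *)

theory Defs
  imports "HOL-Probability.Probability" "HOL-Library.Landau_Symbols"
begin

definition mgf_ext :: "real measure \<Rightarrow> real \<Rightarrow> ennreal" where
  "mgf_ext F s = (\<integral>\<^sup>+ x. ennreal (exp (s * x)) \<partial>F)"

(* Real-valued version, to be differentiated; enn2real sends the value infinity to 0,
   so it is meaningful only where mgf_ext is finite. *)
definition mgf :: "real measure \<Rightarrow> real \<Rightarrow> real" where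
  "mgf F s = enn2real (mgf_ext F s)"

(* The abscissae are extended reals, so that requiring them to be finite is a genuine
   hypothesis, not an artefact of Inf and Sup on unbounded sets of reals. *)
definition q_star :: "real measure \<Rightarrow> ereal" where
  "q_star F = - (INF s\<in>{s. mgf_ext F s < \<infinity>}. ereal s)"

definition r_star :: "real measure \<Rightarrow> ereal" where
  "r_star F = (SUP s\<in>{s. mgf_ext F s < \<infinity>}. ereal s)"

(* Only the values of l on some half-line {a..} matter; measurability is Lebesgue
   measurability there. *)
definition slowly_varying :: "(real \<Rightarrow> real) \<Rightarrow> bool" where
  "slowly_varying l \<longleftrightarrow>
     (\<exists>a. (\<forall>x\<ge>a. l x > 0) \<and> l \<in> borel_measurable (lebesgue_on {a..})) \<and>
     (\<forall>c>0. ((\<lambda>x. l (c * x) / l x) \<longlongrightarrow> 1) at_top)"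

end

theory Submission imports Defs "HOL-Real_Asymp.Real_Asymp" begin

text \<open>Near the right abscissa, \<open>M\<^bsup>(n)\<^esup>(r - s)\<close> is, up to a bounded term, the Laplace transform of
  \<open>y\<^sup>n e\<^bsup>r y\<^esup> dF(y)\<close> on \<open>y > 0\<close>. If it is regularly varying with index \<open>- \<rho> < 0\<close>, then after rescaling by
  \<open>x = 1 / s\<close> these measures, weighted by \<open>e\<^bsup>- s y\<^esup>\<close>, converge to a Gamma distribution on polynomials in \<open>e\<^bsup>- s y\<^esup>\<close>.
  The limit charges \<open>(1, \<mu>)\<close> for every \<open>\<mu> > 1\<close>, so that \<open>x\<^sup>n e\<^bsup>r \<mu> x\<^esup> F((x, \<infinity>))\<close> is bounded
  away from \<open>0\<close>; together with the Chernoff bound this gives the claim on the right. The claim on the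
  left follows by reflection.\<close>

section \<open>Gamma integrals and polynomial approximation\<close>

lemma has_bochner_integral_Gamma_scaled:
  fixes \<rho> c :: real
  assumes "\<rho> > 0" "c > 0"
  shows "has_bochner_integral lborel
           (\<lambda>t. indicator {0..} t * (t powr (\<rho> - 1) * exp (- c * t))) (Gamma \<rho> * c powr (- \<rho>))"
proof -
  have one: "has_bochner_integral lborel
           (\<lambda>t. indicator {0..} t * (t powr (\<rho> - 1) * exp (- t))) (Gamma \<rho>)"
  proof (rule has_bochner_integral_nn_integral)
    show "(\<integral>\<^sup>+t. ennreal (indicator {0..} t * (t powr (\<rho> - 1) * exp (- t))) \<partial>lborel) = ennreal (Gamma \<rho>)"
      using Gamma_conv_nn_integral_real[OF assms(1)] by (simp add: exp_minus divide_inverse mult.assoc)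
  qed (use assms in \<open>auto intro: less_imp_le[OF Gamma_real_pos]\<close>)
  have "has_bochner_integral lborel
      (\<lambda>t. indicator {0..} (0 + c * t) * ((0 + c * t) powr (\<rho> - 1) * exp (- (0 + c * t)))) (Gamma \<rho> /\<^sub>R \<bar>c\<bar>)"
    using one assms by (subst lborel_has_bochner_integral_real_affine_iff[symmetric]) auto
  \<comment> \<open>The factor \<open>c powr (1 - \<rho>)\<close> cancels the power of
    \<open>c\<close> that the substitution \<open>c * t\<close> releases from
    \<open>(c * t) powr (\<rho> - 1)\<close>.\<close>
  from has_bochner_integral_mult_right[OF this, of "c powr (1 - \<rho>)"]
  have "has_bochner_integral lborel
      (\<lambda>t. c powr (1 - \<rho>) * (indicator {0..} (0 + c * t) * ((0 + c * t) powr (\<rho> - 1) * exp (- (0 + c * t)))))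
      (c powr (1 - \<rho>) * (Gamma \<rho> /\<^sub>R \<bar>c\<bar>))" by simp
  also have "c powr (1 - \<rho>) * (Gamma \<rho> /\<^sub>R \<bar>c\<bar>) = Gamma \<rho> * c powr (- \<rho>)"
    using assms by (simp add: powr_diff powr_minus field_simps)
  also have "(\<lambda>t. c powr (1 - \<rho>) * (indicator {0..} (0 + c * t) * ((0 + c * t) powr (\<rho> - 1) * exp (- (0 + c * t)))))
     = (\<lambda>t. indicator {0..} t * (t powr (\<rho> - 1) * exp (- c * t)))"
  proof
    fix t :: real
    have "c powr (1 - \<rho>) * (c * t) powr (\<rho> - 1) = t powr (\<rho> - 1)" if "t \<ge> 0"
      using that assms by (simp add: powr_mult mult.assoc[symmetric] powr_add[symmetric])
    then show "c powr (1 - \<rho>) * (indicator {0..} (0 + c * t) * ((0 + c * t) powr (\<rho> - 1) * exp (- (0 + c * t))))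
        = indicator {0..} t * (t powr (\<rho> - 1) * exp (- c * t))"
      using assms by (auto simp: indicator_def zero_le_mult_iff)
  qed
  finally show ?thesis .
qed

text \<open>The sum in the conclusion is \<open>1 / Gamma \<rho>\<close> times the integral of the polynomial, evaluated
  at \<open>exp (- t)\<close>, against the Gamma density with shape \<open>\<rho>\<close>.\<close>
lemma polynomial_minorant_Gamma:
  fixes \<rho> \<mu> :: real
  assumes "\<rho> > 0" "\<mu> > 1"
  obtains a :: "nat \<Rightarrow> real" and m where
    "\<forall>u\<in>{0..1}. (\<Sum>i\<le>m. a i * u ^ i) \<le> indicator {exp (- \<mu>)<..<exp (- 1)} u"
    "(\<Sum>i\<le>m. a i * real (i + 1) powr (- \<rho>)) > 0"
proof -
  define w where "w = (\<lambda>t::real. indicator {0..} t * (t powr (\<rho> - 1) * exp (- t)))"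
  \<comment> \<open>A continuous minorant of the indicator on \<open>{0..1}\<close>: the product of
    the linear factors is positive exactly between its two zeros, and there at most 1.\<close>
  define f where "f = (\<lambda>u::real. max 0 ((u - exp (- \<mu>)) * (exp (- 1) - u)))"
  define J where "J = (\<integral>t. w t * f (exp (- t)) \<partial>lborel)"
  have w: "has_bochner_integral lborel w (Gamma \<rho>)"
    using has_bochner_integral_Gamma_scaled[OF assms(1), of 1] by (simp add: w_def)
  have w0: "w t \<ge> 0" for t by (simp add: w_def)
  have \<Gamma>: "Gamma \<rho> > 0" using assms by simp
  have [measurable]: "w \<in> borel_measurable borel" by (simp add: w_def)
  have [measurable]: "f \<in> borel_measurable borel" by (simp add: f_def)
  have f_pos: "f u > 0 \<longleftrightarrow> u \<in> {exp (- \<mu>)<..<exp (- 1)}" for u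
  proof -
    have "\<not> (u < exp (-\<mu>) \<and> exp (-1) < u)" using assms by (smt (verit) exp_le_cancel_iff)
    then show ?thesis by (auto simp: f_def zero_less_mult_iff less_max_iff_disj)
  qed
  have f0: "f u \<ge> 0" for u by (simp add: f_def)
  have f1: "f u \<le> 1" if "u \<in> {0..1}" for u
  proof (cases "f u > 0")
    case True
    then have "u \<in> {exp (- \<mu>)<..<exp (- 1)}" using f_pos by blast
    moreover have "exp (- 1) \<le> (1::real)" by simp
    ultimately have "0 \<le> u - exp (- \<mu>)" "0 \<le> exp (- 1) - u" "u - exp (- \<mu>) \<le> 1" "exp (- 1) - u \<le> 1"
      using that exp_gt_zero[of "- \<mu>"] unfolding atLeastAtMost_iff greaterThanLessThan_iff by linarith+
    then have "(u - exp (- \<mu>)) * (exp (- 1) - u) \<le> 1 * 1"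
      by (intro mult_mono) auto
    then show ?thesis by (simp add: f_def)
  qed auto
  have int_f: "integrable lborel (\<lambda>t. w t * f (exp (- t)))"
  proof (rule Bochner_Integration.integrable_bound)
    show "integrable lborel w" using w by (simp add: has_bochner_integral_iff)
    show "AE t in lborel. norm (w t * f (exp (- t))) \<le> norm (w t)"
    proof (rule AE_I2)
      fix t
      show "norm (w t * f (exp (- t))) \<le> norm (w t)"
        using f1[of "exp (-t)"] f0[of "exp (-t)"] w0[of t]
        by (cases "t \<ge> 0") (auto simp: abs_mult mult_left_le w_def)
    qed
  qed simp
  \<comment> \<open>If \<open>J\<close> vanished, the nonnegative integrand would be zero almost
    everywhere; but it is positive on \<open>{1<..<\<mu>}\<close>, an interval of positive
    length.\<close>
  have "J \<noteq> 0"
  proof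
    assume "J = 0"
    then have "AE t in lborel. w t * f (exp (- t)) = 0"
      unfolding J_def using int_f w0 f0 by (subst (asm) integral_nonneg_eq_0_iff_AE) auto
    then have "AE t in lborel. t \<notin> {1<..<\<mu>}"
    proof eventually_elim
      case (elim t)
      show ?case
      proof
        assume t: "t \<in> {1<..<\<mu>}"
        then have "f (exp (- t)) > 0" by (subst f_pos) auto
        moreover have "w t > 0" using t by (simp add: w_def)
        ultimately show False using elim by simp
      qed
    qed
    then have "emeasure lborel {1<..<\<mu>} = 0"
      by (subst (asm) AE_iff_measurable[where N = "{1<..<\<mu>}"]) auto
    then show False using assms by simp
  qed
  moreover have "J \<ge> 0" unfolding J_def using w0 f0 by (intro integral_nonneg_AE) auto
  ultimately have J: "J > 0" by simp
  \<comment> \<open>Approximating \<open>f\<close> within \<open>\<eta>\<close> and then lowering by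
    \<open>\<eta>\<close> costs at most \<open>2 * \<eta>\<close> times the mass
    \<open>Gamma \<rho>\<close> of \<open>w\<close>, which is half of \<open>J\<close>.\<close>
  define \<eta> where "\<eta> = J / (4 * Gamma \<rho>)"
  have \<eta>: "\<eta> > 0" using J \<Gamma> by (simp add: \<eta>_def)
  have "continuous_on {0..1} f" unfolding f_def by (intro continuous_intros)
  then obtain g where g: "real_polynomial_function g" "\<And>u. u \<in> {0..1} \<Longrightarrow> \<bar>f u - g u\<bar> < \<eta>"
    using Stone_Weierstrass_real_polynomial_function[of "{0..1}" f \<eta>] \<eta> by auto
  \<comment> \<open>The approximant lowered by \<open>\<eta>\<close> lies below \<open>f\<close>,
    hence below the indicator, on all of \<open>{0..1}\<close>.\<close>
  have "real_polynomial_function (\<lambda>u. g u - \<eta>)"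
    using g(1) by (intro real_polynomial_function_diff real_polynomial_function.intros(2))
  then obtain a m where am: "(\<lambda>u. g u - \<eta>) = (\<lambda>u. \<Sum>i\<le>m. a i * u ^ i)"
    unfolding real_polynomial_function_iff_sum by blast
  have Q: "(\<Sum>i\<le>m. a i * u ^ i) = g u - \<eta>" for u using am by metis
  \<comment> \<open>At \<open>u = exp (- t)\<close> the monomial \<open>u ^ i\<close> raises the
    rate of the weight from 1 to \<open>i + 1\<close>; this is the source of the shift in the
    sum.\<close>
  have int_Q: "has_bochner_integral lborel (\<lambda>t. w t * (\<Sum>i\<le>m. a i * exp (- t) ^ i))
      (\<Sum>i\<le>m. a i * (Gamma \<rho> * real (i + 1) powr (- \<rho>)))"
  proof -
    have "has_bochner_integral lborel
        (\<lambda>t. \<Sum>i\<le>m. a i * (indicator {0..} t * (t powr (\<rho> - 1) * exp (- real (i + 1) * t))))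
        (\<Sum>i\<le>m. a i * (Gamma \<rho> * real (i + 1) powr (- \<rho>)))"
      using assms by (intro has_bochner_integral_sum has_bochner_integral_mult_right
          has_bochner_integral_Gamma_scaled) auto
    also have "(\<lambda>t. \<Sum>i\<le>m. a i * (indicator {0..} t * (t powr (\<rho> - 1) * exp (- real (i + 1) * t))))
        = (\<lambda>t. w t * (\<Sum>i\<le>m. a i * exp (- t) ^ i))"
      by (auto simp: w_def sum_distrib_left exp_of_nat_mult[symmetric] exp_add[symmetric]
            algebra_simps fun_eq_iff mult_exp_exp intro!: sum.cong)
    finally show ?thesis .
  qed
  have "J - 2 * \<eta> * Gamma \<rho> = (\<integral>t. w t * f (exp (- t)) - 2 * \<eta> * w t \<partial>lborel)"
    using int_f w by (simp add: J_def has_bochner_integral_iff)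
  also have "\<dots> \<le> (\<integral>t. w t * (\<Sum>i\<le>m. a i * exp (- t) ^ i) \<partial>lborel)"
  proof (rule integral_mono)
    fix t
    show "w t * f (exp (- t)) - 2 * \<eta> * w t \<le> w t * (\<Sum>i\<le>m. a i * exp (- t) ^ i)"
    proof (cases "t \<ge> 0")
      case True
      then have "f (exp (- t)) - 2 * \<eta> \<le> (\<Sum>i\<le>m. a i * exp (- t) ^ i)"
        using g(2)[of "exp (- t)"] by (simp add: Q)
      from mult_left_mono[OF this w0[of t]] show ?thesis by (simp add: algebra_simps)
    qed (simp add: w_def)
  qed (use int_f w int_Q in \<open>auto simp: has_bochner_integral_iff\<close>)
  also have "\<dots> = Gamma \<rho> * (\<Sum>i\<le>m. a i * real (i + 1) powr (- \<rho>))"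
    using int_Q by (simp add: has_bochner_integral_iff sum_distrib_left mult_ac)
  finally have "Gamma \<rho> * (\<Sum>i\<le>m. a i * real (i + 1) powr (- \<rho>)) > 0"
    using J \<Gamma> by (simp add: \<eta>_def)
  then have "(\<Sum>i\<le>m. a i * real (i + 1) powr (- \<rho>)) > 0"
    using \<Gamma> by (simp add: zero_less_mult_iff)
  moreover have "(\<Sum>i\<le>m. a i * u ^ i) \<le> indicator {exp (- \<mu>)<..<exp (- 1)} u" if "u \<in> {0..1}" for u
    using g(2)[OF that] f1[OF that] f_pos[of u] f0[of u] by (auto simp: Q indicator_def)
  ultimately show ?thesis using that by blast
qed

section \<open>Exponential moments and derivatives of the moment generating function\<close>

lemma power_div_fact_le_exp:
  fixes x :: real
  assumes "0 \<le> x"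
  shows "x ^ n / fact n \<le> exp x"
proof -
  have "(\<Sum>i\<in>{n}. x ^ i /\<^sub>R fact i) \<le> (\<Sum>i. x ^ i /\<^sub>R fact i)"
    using assms by (intro sum_le_suminf summable_exp_generic) auto
  then show ?thesis by (simp add: exp_def field_simps)
qed

context finite_borel_measure
begin

lemma measurable_M_eq: "borel_measurable M = borel_measurable borel"
  using M_is_borel by (simp cong: measurable_cong_sets)

lemma space_M_UNIV: "space M = UNIV"
  using M_is_borel by (simp cong: sets_eq_imp_space_eq)

lemma integrable_exp_iff: "integrable M (\<lambda>y. exp (s * y)) \<longleftrightarrow> mgf_ext M s < \<infinity>"
  by (simp add: integrable_iff_bounded mgf_ext_def measurable_M_eq)

text \<open>Where the exponential is not integrable, both sides take the default value 0:
  \<open>enn2real\<close> of infinity and the Bochner integral.\<close>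

lemma mgf_eq_integral: "mgf M s = (\<integral>y. exp (s * y) \<partial>M)"
  unfolding mgf_def mgf_ext_def by (subst integral_eq_nn_integral) (auto simp: measurable_M_eq)

end

text \<open>Integrability is recorded on an open interval around 0 and nothing is said at its ends,
  so reflection yields another instance, with ends \<open>- b\<close> and
  \<open>- a\<close>.\<close>

locale two_sided_exponential_moments = finite_borel_measure +
  fixes a b :: real
  assumes a_neg: "a < 0" and b_pos: "0 < b"
    and integrable_exp: "\<And>s. a < s \<Longrightarrow> s < b \<Longrightarrow> integrable M (\<lambda>y. exp (s * y))"
begin

text \<open>A power of \<open>\<bar>y\<bar>\<close> is dominated by a multiple of
  \<open>exp (h * y) + exp (- h * y)\<close>, so it is absorbed by moving the exponent
  \<open>s\<close> a little to either side.\<close>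

lemma integrable_power_exp:
  assumes "a < s" "s < b"
  shows "integrable M (\<lambda>y. y ^ n * exp (s * y))"
proof -
  define h where "h = min (s - a) (b - s) / 2"
  have h: "h > 0" "a < s - h" "s + h < b" using assms by (auto simp: h_def min_def field_simps)
  have bound: "\<bar>y\<bar> ^ n * exp (s * y) \<le> fact n / h ^ n * (exp ((s + h) * y) + exp ((s - h) * y))" for y
  proof -
    have "(h * \<bar>y\<bar>) ^ n / fact n \<le> exp (h * \<bar>y\<bar>)"
      using h by (intro power_div_fact_le_exp) auto
    also have "\<dots> \<le> exp (h * y) + exp (- h * y)" by (cases "y \<ge> 0") auto
    finally have "\<bar>y\<bar> ^ n \<le> fact n / h ^ n * (exp (h * y) + exp (- h * y))"
      using h by (simp add: power_mult_distrib field_simps)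
    from mult_right_mono[OF this, of "exp (s * y)"]
    show ?thesis by (simp add: algebra_simps mult_exp_exp)
  qed
  show ?thesis
  proof (rule Bochner_Integration.integrable_bound)
    show "integrable M (\<lambda>y. fact n / h ^ n * (exp ((s + h) * y) + exp ((s - h) * y)))"
      using h assms by (intro integrable_mult_right Bochner_Integration.integrable_add integrable_exp) auto
    show "AE y in M. norm (y ^ n * exp (s * y))
        \<le> norm (fact n / h ^ n * (exp ((s + h) * y) + exp ((s - h) * y)))"
      using bound h by (intro AE_I2) (auto simp: abs_mult power_abs intro!: order_trans[OF bound])
  qed (simp add: measurable_M_eq)
qed

text \<open>Differentiation under the integral by dominated convergence. The mean value theorem
  turns the difference quotient into \<open>y ^ Suc n * exp (t * y)\<close> with \<open>t\<close>
  near \<open>s\<close>, and the two extreme exponents \<open>s + d\<close> and \<open>s - d\<close>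
  dominate it.\<close>

lemma has_field_derivative_integral_power_exp:
  assumes "a < s" "s < b"
  shows "((\<lambda>s. \<integral>y. y ^ n * exp (s * y) \<partial>M) has_field_derivative (\<integral>y. y ^ Suc n * exp (s * y) \<partial>M)) (at s)"
proof -
  define d where "d = min (s - a) (b - s) / 2"
  have d: "d > 0" "a < s - d" "s + d < b" using assms by (auto simp: d_def min_def field_simps)
  define D where "D = (\<lambda>h y::real. (y ^ n * exp ((s + h) * y) - y ^ n * exp (s * y)) / h)"
  have bound: "\<bar>D h y\<bar> \<le> \<bar>y ^ Suc n * exp ((s + d) * y)\<bar> + \<bar>y ^ Suc n * exp ((s - d) * y)\<bar>"
    if h: "h \<in> {- d<..<d} - {0}" for h y
  proof -
    \<comment> \<open>The mean value theorem wants ordered endpoints, hence a case for each sign of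
      \<open>h\<close>.\<close>
    have "\<exists>t. \<bar>t - s\<bar> \<le> \<bar>h\<bar> \<and> exp ((s + h) * y) - exp (s * y) = h * (y * exp (t * y))"
    proof (cases "h > 0")
      case True
      have "\<exists>t>s. t < s + h \<and> exp ((s + h) * y) - exp (s * y) = (s + h - s) * (y * exp (t * y))"
        using True by (intro MVT2) (auto intro!: derivative_eq_intros)
      then obtain t where "s < t" "t < s + h"
        "exp ((s + h) * y) - exp (s * y) = h * (y * exp (t * y))" by auto
      then show ?thesis by (intro exI[of _ t]) auto
    next
      case False
      have "\<exists>t>s + h. t < s \<and> exp (s * y) - exp ((s + h) * y) = (s - (s + h)) * (y * exp (t * y))"
        using False h by (intro MVT2) (auto intro!: derivative_eq_intros)
      then obtain t where "s + h < t" "t < s"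
        "exp (s * y) - exp ((s + h) * y) = (s - (s + h)) * (y * exp (t * y))" by auto
      then show ?thesis by (intro exI[of _ t]) (auto simp: algebra_simps)
    qed
    then obtain t where t: "\<bar>t - s\<bar> \<le> \<bar>h\<bar>" "exp ((s + h) * y) - exp (s * y) = h * (y * exp (t * y))"
      by blast
    have "D h y = y ^ n * (exp ((s + h) * y) - exp (s * y)) / h"
      by (simp add: D_def right_diff_distrib)
    also have "\<dots> = y ^ Suc n * exp (t * y)" using h by (simp add: t(2))
    finally have D: "\<bar>D h y\<bar> = \<bar>y\<bar> ^ Suc n * exp (t * y)" by (simp add: abs_mult power_abs)
    have "s - d \<le> t" "t \<le> s + d" using t(1) h by auto
    then have "exp (t * y) \<le> exp ((s + d) * y) + exp ((s - d) * y)"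
    proof (cases "y \<ge> 0")
      case True
      then have "exp (t * y) \<le> exp ((s + d) * y)" using \<open>t \<le> s + d\<close> by (simp add: mult_right_mono)
      then show ?thesis by (simp add: add_increasing2)
    next
      case False
      then have "exp (t * y) \<le> exp ((s - d) * y)" using \<open>s - d \<le> t\<close> by (simp add: mult_right_mono_neg)
      then show ?thesis by (simp add: add_increasing)
    qed
    from mult_left_mono[OF this, of "\<bar>y\<bar> ^ Suc n"] D
    show ?thesis by (simp add: abs_mult power_abs distrib_left)
  qed
  \<comment> \<open>Dominated convergence concerns sequences; restricting \<open>h\<close> to
    \<open>{- d<..<d}\<close> puts every term of the sequence under the dominating function.\<close>
  have lim: "((\<lambda>h. \<integral>y. D h y \<partial>M) \<longlongrightarrow> (\<integral>y. y ^ Suc n * exp (s * y) \<partial>M)) (at 0 within {- d<..<d})"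
    unfolding tendsto_at_iff_sequentially o_def
  proof (intro allI impI)
    fix X :: "nat \<Rightarrow> real"
    assume X: "\<forall>i. X i \<in> {- d<..<d} - {0}" "X \<longlonglongrightarrow> 0"
    show "(\<lambda>i. \<integral>y. D (X i) y \<partial>M) \<longlonglongrightarrow> (\<integral>y. y ^ Suc n * exp (s * y) \<partial>M)"
    proof (rule integral_dominated_convergence)
      show "integrable M (\<lambda>y. \<bar>y ^ Suc n * exp ((s + d) * y)\<bar> + \<bar>y ^ Suc n * exp ((s - d) * y)\<bar>)"
        using d assms by (intro Bochner_Integration.integrable_add integrable_abs integrable_power_exp) auto
      show "AE y in M. (\<lambda>i. D (X i) y) \<longlonglongrightarrow> y ^ Suc n * exp (s * y)"
      proof (rule AE_I2)
        fix y :: real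
        have "((\<lambda>s. y ^ n * exp (s * y)) has_field_derivative y ^ Suc n * exp (s * y)) (at s)"
          by (auto intro!: derivative_eq_intros)
        then have "((\<lambda>h. D h y) \<longlongrightarrow> y ^ Suc n * exp (s * y)) (at 0)"
          by (simp add: DERIV_def D_def)
        then show "(\<lambda>i. D (X i) y) \<longlonglongrightarrow> y ^ Suc n * exp (s * y)"
          using X unfolding tendsto_at_iff_sequentially o_def by auto
      qed
      show "AE y in M. norm (D (X i) y)
          \<le> \<bar>y ^ Suc n * exp ((s + d) * y)\<bar> + \<bar>y ^ Suc n * exp ((s - d) * y)\<bar>" for i
        using bound X by (intro AE_I2) auto
    qed (auto simp: measurable_M_eq D_def)
  qed
  have "((\<lambda>h. ((\<integral>y. y ^ n * exp ((s + h) * y) \<partial>M) - (\<integral>y. y ^ n * exp (s * y) \<partial>M)) / h)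
      \<longlongrightarrow> (\<integral>y. y ^ Suc n * exp (s * y) \<partial>M)) (at 0 within {- d<..<d})"
    using lim
  proof (rule Lim_transform_eventually)
    have "eventually (\<lambda>h. h \<in> {- d<..<d}) (at 0 within {- d<..<d})"
      by (auto simp: eventually_at_filter)
    then show "\<forall>\<^sub>F h in at 0 within {- d<..<d}. (\<integral>y. D h y \<partial>M) =
        ((\<integral>y. y ^ n * exp ((s + h) * y) \<partial>M) - (\<integral>y. y ^ n * exp (s * y) \<partial>M)) / h"
    proof eventually_elim
      case (elim h)
      then have "a < s + h" "s + h < b" using d by auto
      then show ?case unfolding D_def
        using assms integrable_power_exp by (simp add: Bochner_Integration.integral_diff)
    qed
  qed
  then show ?thesis
    using d by (simp add: DERIV_def at_within_open[of _ "{- d<..<d}"])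
qed

lemma higher_deriv_mgf:
  assumes "a < s" "s < b"
  shows "(deriv ^^ n) (mgf M) s = (\<integral>y. y ^ n * exp (s * y) \<partial>M)"
  using assms
proof (induction n arbitrary: s)
  case 0
  then show ?case by (simp add: mgf_eq_integral)
next
  case (Suc n)
  \<comment> \<open>The induction hypothesis identifies the \<open>n\<close>-th derivative with the
    integral on a whole open interval around \<open>s\<close>, so the derivative transfers.\<close>
  have "((deriv ^^ n) (mgf M) has_field_derivative (\<integral>y. y ^ Suc n * exp (s * y) \<partial>M)) (at s)"
    using has_field_derivative_integral_power_exp[OF Suc.prems, of n]
    by (rule has_field_derivative_transform_within_open[of _ _ _ "{a<..<b}"]) (use Suc in auto)
  then show ?case by (simp add: DERIV_imp_deriv)
qed

end

section \<open>Regular variation at zero\<close>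

lemma filterlim_mult_at_right_0:
  fixes c :: real
  assumes "c > 0"
  shows "filterlim (\<lambda>s. c * s) (at_right 0) (at_right 0)"
  using assms unfolding filterlim_at
  by (auto intro!: tendsto_eq_intros eventually_at_right_less[THEN eventually_mono])

text \<open>Both properties are checked for the explicit right-hand side and carried over by
  asymptotic equivalence. Since \<open>1 / (c * s)\<close> is \<open>1 / c\<close> times
  \<open>1 / s\<close>, slow variation is used with the factor \<open>1 / c\<close>.\<close>

lemma regularly_varying_at_0:
  fixes \<phi> l :: "real \<Rightarrow> real"
  assumes "slowly_varying l"
    and equiv: "\<phi> \<sim>[at_right 0] (\<lambda>s. s powr (- \<rho>) * l (1 / s))"
  shows regularly_varying_eventually_pos: "\<forall>\<^sub>F s in at_right 0. \<phi> s > 0"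
    and regularly_varying_ratio: "c > 0 \<Longrightarrow> ((\<lambda>s. \<phi> (c * s) / \<phi> s) \<longlongrightarrow> c powr (- \<rho>)) (at_right 0)"
proof -
  define g where "g = (\<lambda>s. s powr (- \<rho>) * l (1 / s))"
  have inv: "filterlim (\<lambda>s::real. 1 / s) at_top (at_right 0)"
    using filterlim_inverse_at_top_right by (simp add: inverse_eq_divide)
  obtain A where "\<forall>x\<ge>A. l x > 0" using assms(1) by (auto simp: slowly_varying_def)
  then have "\<forall>\<^sub>F x in at_top. l x > 0" by (auto simp: eventually_at_top_linorder)
  then have "\<forall>\<^sub>F s in at_right 0. l (1 / s) > 0"
    using inv by (rule eventually_compose_filterlim)
  then have g: "\<forall>\<^sub>F s in at_right 0. g s > 0"
    using eventually_at_right_less[of 0] by eventually_elim (simp add: g_def)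
  have equiv': "\<phi> \<sim>[at_right 0] g" using equiv by (simp add: g_def)
  show pos: "\<forall>\<^sub>F s in at_right 0. \<phi> s > 0"
    using asymp_equiv_eventually_pos_iff[OF equiv'] g by eventually_elim simp
  assume c: "c > 0"
  have "((\<lambda>x. l (1 / c * x) / l x) \<longlongrightarrow> 1) at_top"
    using assms(1) divide_pos_pos[OF zero_less_one c] unfolding slowly_varying_def by blast
  from filterlim_compose[OF this inv]
  have "((\<lambda>s. c powr (- \<rho>) * (l (1 / c * (1 / s)) / l (1 / s))) \<longlongrightarrow> c powr (- \<rho>) * 1) (at_right 0)"
    by (intro tendsto_intros) auto
  moreover have "\<forall>\<^sub>F s in at_right 0. c powr (- \<rho>) * (l (1 / c * (1 / s)) / l (1 / s)) = g (c * s) / g s"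
    using eventually_at_right_less[of 0]
    by eventually_elim (use c in \<open>simp add: g_def powr_mult\<close>)
  ultimately have "((\<lambda>s. g (c * s) / g s) \<longlongrightarrow> c powr (- \<rho>)) (at_right 0)"
    using Lim_transform_eventually by fastforce
  moreover have "(\<lambda>s. \<phi> (c * s) / \<phi> s) \<sim>[at_right 0] (\<lambda>s. g (c * s) / g s)"
    by (intro asymp_equiv_divide equiv' asymp_equiv_compose'[OF equiv' filterlim_mult_at_right_0[OF c]])
  ultimately show "((\<lambda>s. \<phi> (c * s) / \<phi> s) \<longlongrightarrow> c powr (- \<rho>)) (at_right 0)"
    by (simp add: asymp_equiv_sym tendsto_asymp_equiv_cong)
qed

text \<open>Iterating \<open>\<phi> (s / 2) / \<phi> s \<longlongrightarrow> 2 powr \<rho> > 1\<close> makes \<open>\<phi>\<close>, hence \<open>P\<close>, unbounded along a geometric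
  sequence; monotonicity fills the gaps. This replaces the usual appeal to the uniform
  convergence theorem for slowly varying functions.\<close>
lemma monotone_part_regularly_varying:
  fixes \<phi> P N :: "real \<Rightarrow> real"
  assumes "\<rho> > 0" "d > 0"
    and split: "\<And>s. 0 < s \<Longrightarrow> s < d \<Longrightarrow> \<phi> s = P s + N s"
    and bounded: "\<And>s. 0 < s \<Longrightarrow> s < d \<Longrightarrow> \<bar>N s\<bar> \<le> K"
    and antimono: "\<And>s t. 0 < s \<Longrightarrow> s \<le> t \<Longrightarrow> t < d \<Longrightarrow> P t \<le> P s"
    and pos: "\<forall>\<^sub>F s in at_right 0. \<phi> s > 0"
    and ratio: "\<And>c. c > 0 \<Longrightarrow> ((\<lambda>s. \<phi> (c * s) / \<phi> s) \<longlongrightarrow> c powr (- \<rho>)) (at_right 0)"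
  shows monotone_part_at_top: "filterlim P at_top (at_right 0)"
    and monotone_part_ratio: "c > 0 \<Longrightarrow> ((\<lambda>s. P (c * s) / P s) \<longlongrightarrow> c powr (- \<rho>)) (at_right 0)"
proof -
  \<comment> \<open>The midpoint of 1 and the limiting ratio \<open>2 powr \<rho>\<close>: close to
    0, each halving of \<open>s\<close> multiplies \<open>\<phi>\<close> by at least
    \<open>\<beta>\<close>.\<close>
  define \<beta> where "\<beta> = (1 + 2 powr \<rho>) / 2"
  have "2 powr \<rho> > 1" using assms by simp
  then have \<beta>: "\<beta> > 1" "\<beta> < 2 powr \<rho>" by (auto simp: \<beta>_def)
  have "((\<lambda>s. \<phi> (1 / 2 * s) / \<phi> s) \<longlongrightarrow> 2 powr \<rho>) (at_right 0)"
    using ratio[of "1 / 2"] by (simp add: powr_divide powr_minus)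
  from order_tendstoD(1)[OF this \<beta>(2)] pos
  have "\<forall>\<^sub>F s in at_right 0. \<phi> s > 0 \<and> \<phi> (s / 2) \<ge> \<beta> * \<phi> s"
    by eventually_elim (auto simp: pos_less_divide_eq)
  then obtain e where e: "e > 0" "\<And>s. 0 < s \<Longrightarrow> s < e \<Longrightarrow> \<phi> s > 0 \<and> \<phi> (s / 2) \<ge> \<beta> * \<phi> s"
    unfolding eventually_at_right_field by auto
  define s0 where "s0 = min d e / 2"
  have s0: "0 < s0" "s0 < d" "s0 < e" using e assms by (auto simp: s0_def)
  have s0k: "0 < s0 / 2 ^ k" "s0 / 2 ^ k \<le> s0" for k using s0 by (auto simp: divide_le_eq)
  have growth: "\<phi> (s0 / 2 ^ k) \<ge> \<beta> ^ k * \<phi> s0" for k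
  proof (induction k)
    case (Suc k)
    have "\<beta> ^ Suc k * \<phi> s0 \<le> \<beta> * \<phi> (s0 / 2 ^ k)" using Suc \<beta> by (simp add: mult.assoc)
    also have "\<dots> \<le> \<phi> (s0 / 2 ^ k / 2)" using e(2)[of "s0 / 2 ^ k"] s0k[of k] s0 by auto
    finally show ?case by (simp add: field_simps)
  qed simp
  have \<phi>0: "\<phi> s0 > 0" using e s0 by blast
  show lim: "filterlim P at_top (at_right 0)"
    unfolding filterlim_at_top
  proof
    fix Z
    \<comment> \<open>After \<open>k\<close> halvings \<open>\<phi>\<close> exceeds
      \<open>Z + K\<close>; removing \<open>N\<close>, of size at most \<open>K\<close>, still
      leaves at least \<open>Z\<close> for \<open>P\<close>.\<close>
    obtain k where k: "(Z + K) / \<phi> s0 < \<beta> ^ k" using real_arch_pow[OF \<beta>(1)] by blast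
    have "Z \<le> P s" if s: "0 < s" "s < s0 / 2 ^ k" for s
    proof -
      have "Z + K \<le> \<phi> (s0 / 2 ^ k)" using growth[of k] k \<phi>0 by (simp add: pos_divide_less_eq)
      then have "Z \<le> P (s0 / 2 ^ k)"
        using split[of "s0 / 2 ^ k"] bounded[of "s0 / 2 ^ k"] s0k[of k] s0 by auto
      also have "\<dots> \<le> P s" using s s0k[of k] s0 by (intro antimono) auto
      finally show ?thesis .
    qed
    then show "\<forall>\<^sub>F s in at_right 0. Z \<le> P s"
      using s0k(1)[of k] unfolding eventually_at_right_field by blast
  qed
  assume c: "c > 0"
  have near: "\<forall>\<^sub>F s in at_right 0. 0 < s \<and> s < d"
    using assms(2) unfolding eventually_at_right_field by blast
  have P_pos: "\<forall>\<^sub>F s in at_right 0. P s > 0"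
    using lim by (simp add: filterlim_at_top_dense)
  \<comment> \<open>A bounded \<open>N\<close> is negligible against \<open>P\<close>, so
    \<open>P\<close> is equivalent to \<open>\<phi>\<close> and inherits its ratio limits.\<close>
  have "((\<lambda>s. K / P s) \<longlongrightarrow> 0) (at_right 0)"
    by (rule real_tendsto_divide_at_top[OF tendsto_const lim])
  then have "((\<lambda>s. N s / P s) \<longlongrightarrow> 0) (at_right 0)"
  proof (rule Lim_null_comparison[rotated])
    show "\<forall>\<^sub>F s in at_right 0. norm (N s / P s) \<le> K / P s"
      using near P_pos by eventually_elim (use bounded in \<open>auto intro!: divide_right_mono\<close>)
  qed
  from tendsto_add[OF tendsto_const[of 1] this]
  have "((\<lambda>s. 1 + N s / P s) \<longlongrightarrow> 1) (at_right 0)" by simp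
  moreover have "\<forall>\<^sub>F s in at_right 0. 1 + N s / P s = \<phi> s / P s"
    using near P_pos by eventually_elim (use split in \<open>auto simp: field_simps\<close>)
  ultimately have "((\<lambda>s. \<phi> s / P s) \<longlongrightarrow> 1) (at_right 0)"
    by (rule Lim_transform_eventually)
  then have "\<phi> \<sim>[at_right 0] P" by (rule asymp_equivI')
  then have "P \<sim>[at_right 0] \<phi>" by (rule asymp_equiv_symI)
  then have "(\<lambda>s. P (c * s) / P s) \<sim>[at_right 0] (\<lambda>s. \<phi> (c * s) / \<phi> s)"
    by (intro asymp_equiv_divide asymp_equiv_compose'[OF _ filterlim_mult_at_right_0[OF c]])
  then show "((\<lambda>s. P (c * s) / P s) \<longlongrightarrow> c powr (- \<rho>)) (at_right 0)"
    using ratio[OF c] by (simp add: tendsto_asymp_equiv_cong)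
qed

section \<open>Bounds and logarithmic asymptotics of the right tail\<close>

context two_sided_exponential_moments
begin

text \<open>Karamata's argument: substituting \<open>u = exp (- y / x)\<close> turns the polynomial minorant of the
  indicator of an interval into a minorant of the indicator of \<open>x < y < \<mu> x\<close>, whose integral
  is a combination of values of the transform.\<close>
lemma tail_lower_bound:
  fixes n :: nat and \<rho> \<mu> :: real
  defines "\<phi> \<equiv> \<lambda>s. \<integral>y. y ^ n * exp ((b - s) * y) \<partial>M"
  assumes "\<rho> > 0" "\<mu> > 1"
    and pos: "\<forall>\<^sub>F s in at_right 0. \<phi> s > 0"
    and ratio: "\<And>c. c > 0 \<Longrightarrow> ((\<lambda>s. \<phi> (c * s) / \<phi> s) \<longlongrightarrow> c powr (- \<rho>)) (at_right 0)"
  obtains C where "C > 0"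
    "\<forall>\<^sub>F x in at_top. C \<le> (\<mu> * x) ^ n * exp (b * (\<mu> * x)) * measure M {x<..}"
proof -
  define k where "k = (\<lambda>s y. y ^ n * exp ((b - s) * y))"
  \<comment> \<open>On positive \<open>y\<close> the integrand decreases in \<open>s\<close>, which
    makes \<open>P\<close> monotone; on the rest the exponential is at most 1 for
    \<open>s < b\<close>, which bounds \<open>N\<close>.\<close>
  define P where "P = (\<lambda>s. \<integral>y. indicator {0<..} y * k s y \<partial>M)"
  define N where "N = (\<lambda>s. \<integral>y. indicator {..0} y * k s y \<partial>M)"
  have int_k: "integrable M (k s)" if "0 < s" "s < b" for s
    using that a_neg integrable_power_exp[of "b - s" n] by (simp add: k_def)
  have int_ind: "integrable M (\<lambda>y. indicator A y * k s y)" if "0 < s" "s < b" "A \<in> sets borel" for s A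
    using integrable_real_mult_indicator[OF _ int_k[OF that(1,2)], of A] that(3) M_is_borel
    by (simp add: mult.commute)
  have split: "\<phi> s = P s + N s" if "0 < s" "s < b" for s
  proof -
    have "P s + N s = (\<integral>y. indicator {0<..} y * k s y + indicator {..0} y * k s y \<partial>M)"
      unfolding P_def N_def using that by (intro Bochner_Integration.integral_add[symmetric] int_ind) auto
    also have "\<dots> = (\<integral>y. k s y \<partial>M)"
      by (intro Bochner_Integration.integral_cong) (auto simp: indicator_def)
    finally show ?thesis by (simp add: \<phi>_def k_def)
  qed
  have bounded: "\<bar>N s\<bar> \<le> (\<integral>y. \<bar>y ^ n\<bar> \<partial>M)" if s: "0 < s" "s < b" for s
  proof -
    have "\<bar>N s\<bar> \<le> (\<integral>y. \<bar>indicator {..0} y * k s y\<bar> \<partial>M)"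
      unfolding N_def by (rule integral_abs_bound)
    also have "\<dots> \<le> (\<integral>y. \<bar>y ^ n\<bar> \<partial>M)"
    proof (rule integral_mono)
      show "integrable M (\<lambda>y. \<bar>y ^ n\<bar>)"
        using integrable_power_exp[OF a_neg b_pos, of n] by simp
      fix y
      show "\<bar>indicator {..0} y * k s y\<bar> \<le> \<bar>y ^ n\<bar>"
        using s by (auto simp: k_def indicator_def abs_mult mult_nonneg_nonpos intro!: mult_left_le)
    qed (use s int_ind in auto)
    finally show ?thesis .
  qed
  have antimono: "P t \<le> P s" if "0 < s" "s \<le> t" "t < b" for s t
    unfolding P_def
  proof (rule integral_mono)
    fix y
    show "indicator {0<..} y * k t y \<le> indicator {0<..} y * k s y"
      using that by (auto simp: k_def indicator_def mult_right_mono)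
  qed (use that int_ind in auto)
  note monotone_part = \<open>\<rho> > 0\<close> b_pos split bounded antimono pos ratio
  have P_lim: "filterlim P at_top (at_right 0)"
    by (rule monotone_part_at_top[OF monotone_part])
  have P_ratio: "((\<lambda>s. P (c * s) / P s) \<longlongrightarrow> c powr (- \<rho>)) (at_right 0)" if "c > 0" for c
    by (rule monotone_part_ratio[OF monotone_part that])

  obtain p m where p: "\<forall>u\<in>{0..1}. (\<Sum>i\<le>m. p i * u ^ i) \<le> indicator {exp (- \<mu>)<..<exp (- 1)} u"
    and S: "(\<Sum>i\<le>m. p i * real (i + 1) powr (- \<rho>)) > 0" (is "?S > 0")
    by (rule polynomial_minorant_Gamma[OF \<open>\<rho> > 0\<close> \<open>\<mu> > 1\<close>])
  have "((\<lambda>s. \<Sum>i\<le>m. p i * (P (real (i + 1) * s) / P s)) \<longlongrightarrow> ?S) (at_right 0)"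
    by (intro tendsto_sum tendsto_mult tendsto_const P_ratio) auto
  then have "\<forall>\<^sub>F s in at_right 0. (\<Sum>i\<le>m. p i * (P (real (i + 1) * s) / P s)) > ?S / 2"
    using S by (intro order_tendstoD) auto
  \<comment> \<open>With \<open>P s\<close> at least 1, the bound on the normalised sum becomes an
    absolute one with the same constant.\<close>
  moreover have "\<forall>\<^sub>F s in at_right 0. P s \<ge> 1"
    using P_lim by (simp add: filterlim_at_top)
  ultimately have "\<forall>\<^sub>F s in at_right 0. (\<Sum>i\<le>m. p i * P (real (i + 1) * s)) \<ge> ?S / 2"
  proof eventually_elim
    case (elim s)
    have "?S / 2 \<le> ?S / 2 * P s" using S elim(2) by simp
    also have "\<dots> \<le> (\<Sum>i\<le>m. p i * (P (real (i + 1) * s) / P s)) * P s"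
      using elim by (intro mult_right_mono) auto
    also have "\<dots> = (\<Sum>i\<le>m. p i * P (real (i + 1) * s))"
      using elim(2) by (simp add: sum_distrib_right)
    finally show ?case .
  qed
  then have "\<forall>\<^sub>F x in at_top. (\<Sum>i\<le>m. p i * P (real (i + 1) * inverse x)) \<ge> ?S / 2"
    using filterlim_inverse_at_right_top by (rule eventually_compose_filterlim)
  \<comment> \<open>This puts all arguments \<open>(i + 1) / x\<close> with \<open>i \<le> m\<close>
    into the range \<open>(0, b)\<close> where the integrals exist.\<close>
  moreover have "\<forall>\<^sub>F x in at_top. x > real (m + 1) / b"
    by (rule eventually_gt_at_top)
  ultimately have "\<forall>\<^sub>F x in at_top. ?S / 2 \<le> (\<mu> * x) ^ n * exp (b * (\<mu> * x)) * measure M {x<..}"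
  proof eventually_elim
    case (elim x)
    have x: "x > 0" using elim(2) b_pos by (smt (verit) divide_nonneg_pos of_nat_0_le_iff)
    have small: "0 < real (i + 1) * inverse x \<and> real (i + 1) * inverse x < b" if "i \<le> m" for i
    proof -
      have "real (i + 1) \<le> real (m + 1)" using that by simp
      also have "\<dots> < b * x" using elim(2) b_pos by (simp add: field_simps)
      finally show ?thesis using x by (simp add: field_simps)
    qed
    have int_x: "integrable M (\<lambda>y. p i * (indicator {0<..} y * k (real (i + 1) * inverse x) y))"
      if "i \<le> m" for i
      using small[OF that] by (intro integrable_mult_right int_ind) auto
    \<comment> \<open>Raising the argument from \<open>1 / x\<close> to \<open>(i + 1) / x\<close>
      contributes \<open>exp (- y / x) ^ i\<close>, so a common kernel multiplies the
      polynomial.\<close>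
    have factor: "(\<Sum>i\<le>m. p i * (indicator {0<..} y * k (real (i + 1) * inverse x) y))
        = indicator {0<..} y * k (inverse x) y * (\<Sum>i\<le>m. p i * exp (- y / x) ^ i)" for y
    proof -
      have "k (real (i + 1) * inverse x) y = k (inverse x) y * exp (- y / x) ^ i" for i
      proof -
        have "(b - real (i + 1) * inverse x) * y = (b - inverse x) * y + real i * (- y / x)"
          using x by (simp add: divide_inverse algebra_simps)
        then show ?thesis by (simp only: k_def exp_add exp_of_nat_mult mult.assoc)
      qed
      then show ?thesis by (simp add: sum_distrib_left mult_ac)
    qed
    have "?S / 2 \<le> (\<Sum>i\<le>m. p i * P (real (i + 1) * inverse x))" by (rule elim(1))
    also have "\<dots> = (\<integral>y. (\<Sum>i\<le>m. p i * (indicator {0<..} y * k (real (i + 1) * inverse x) y)) \<partial>M)"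
      using int_x by (simp add: P_def Bochner_Integration.integral_sum)
    also have "\<dots> \<le> (\<integral>y. (\<mu> * x) ^ n * exp (b * (\<mu> * x)) * indicator {x<..} y \<partial>M)"
    proof (rule integral_mono)
      show "integrable M (\<lambda>y. \<Sum>i\<le>m. p i * (indicator {0<..} y * k (real (i + 1) * inverse x) y))"
        using int_x by (intro Bochner_Integration.integrable_sum) auto
      show "integrable M (\<lambda>y. (\<mu> * x) ^ n * exp (b * (\<mu> * x)) * indicator {x<..} y)"
        by (intro integrable_mult_right integrable_real_indicator) (auto simp: emeasure_eq_measure)
      fix y
      show "(\<Sum>i\<le>m. p i * (indicator {0<..} y * k (real (i + 1) * inverse x) y))
          \<le> (\<mu> * x) ^ n * exp (b * (\<mu> * x)) * indicator {x<..} y"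
      proof (cases "y > 0")
        case True
        have k0: "k (inverse x) y \<ge> 0" using True by (simp add: k_def)
        have "k (inverse x) y * (\<Sum>i\<le>m. p i * exp (- y / x) ^ i)
            \<le> k (inverse x) y * indicator {exp (- \<mu>)<..<exp (- 1)} (exp (- y / x))"
          using True x by (intro mult_left_mono p[rule_format] k0) auto
        also have "\<dots> \<le> (\<mu> * x) ^ n * exp (b * (\<mu> * x)) * indicator {x<..} y"
        \<comment> \<open>Inside the interval the kernel is bounded by its factors at
          \<open>\<mu> * x\<close>, with \<open>- inverse x\<close> dropped; outside it the
          indicator vanishes.\<close>
        proof (cases "x < y \<and> y < \<mu> * x")
          case inside: True
          have "(b - inverse x) * y \<le> b * y" using x True by (intro mult_right_mono) auto
          also have "\<dots> \<le> b * (\<mu> * x)" using inside b_pos by (intro mult_left_mono) auto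
          finally have "k (inverse x) y \<le> (\<mu> * x) ^ n * exp (b * (\<mu> * x))"
            unfolding k_def using inside True by (intro mult_mono power_mono) auto
          then show ?thesis using inside k0 by (auto simp: indicator_def)
        next
          case False
          then have "exp (- y / x) \<notin> {exp (- \<mu>)<..<exp (- 1)}"
            using x by (auto simp: field_simps)
          then show ?thesis using x \<open>\<mu> > 1\<close> by simp
        qed
        finally show ?thesis unfolding factor using True by simp
      qed (use x \<open>\<mu> > 1\<close> in simp)
    qed
    also have "\<dots> = (\<mu> * x) ^ n * exp (b * (\<mu> * x)) * measure M {x<..}"
      by (simp add: space_M_UNIV)
    finally show ?case .
  qed
  then show ?thesis using S that[of "?S / 2"] by simp
qed

text \<open>The indicator of \<open>{x..}\<close> lies below \<open>exp (s * (y - x))\<close>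
  pointwise; integrate.\<close>

lemma chernoff_bound:
  assumes "0 < s" "s < b"
  shows "measure M {x..} \<le> exp (- s * x) * (\<integral>y. exp (s * y) \<partial>M)"
proof -
  have int: "integrable M (\<lambda>y. exp (s * y))" using assms a_neg by (intro integrable_exp) auto
  have "measure M {x..} = (\<integral>y. indicator {x..} y \<partial>M)" by (simp add: space_M_UNIV)
  also have "\<dots> \<le> (\<integral>y. exp (- s * x) * exp (s * y) \<partial>M)"
  proof (rule integral_mono)
    fix y
    show "indicator {x..} y \<le> exp (- s * x) * exp (s * y)"
      using assms by (auto simp: indicator_def mult_exp_exp)
  qed (use int in \<open>auto simp: emeasure_eq_measure intro!: integrable_real_indicator\<close>)
  finally show ?thesis by simp
qed

text \<open>The quotient of the two sides is squeezed: Chernoff with \<open>s\<close> close to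
  \<open>b\<close> bounds it from below, the tail bound with \<open>\<mu>\<close> close to 1 from
  above. Placing \<open>g\<close> between the open and the closed tail covers both forms of
  half-line in the final claim.\<close>

theorem ln_tail_asymp_equiv:
  fixes n :: nat and \<rho> :: real and l g :: "real \<Rightarrow> real"
  assumes "\<rho> > 0" "slowly_varying l"
    and equiv: "(\<lambda>s. \<integral>y. y ^ n * exp ((b - s) * y) \<partial>M) \<sim>[at_right 0] (\<lambda>s. s powr (- \<rho>) * l (1 / s))"
    and g: "\<And>x. measure M {x<..} \<le> g x" "\<And>x. g x \<le> measure M {x..}"
  shows "(\<lambda>x. ln (g x)) \<sim>[at_top] (\<lambda>x. - b * x)"
proof (rule asymp_equivI', rule order_tendstoI)
  have lower: "\<exists>C>0. \<forall>\<^sub>F x in at_top. C \<le> (\<mu> * x) ^ n * exp (b * (\<mu> * x)) * measure M {x<..}"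
    if "\<mu> > 1" for \<mu>
    using tail_lower_bound[OF assms(1) that regularly_varying_eventually_pos[OF assms(2) equiv]
        regularly_varying_ratio[OF assms(2) equiv]] by blast
  \<comment> \<open>The logarithms need a nonzero tail; a positive lower bound on the product, here
    with \<open>\<mu> = 2\<close>, excludes measure zero.\<close>
  have g_pos: "\<forall>\<^sub>F x in at_top. g x > 0"
  proof -
    obtain C where C: "C > 0" "\<forall>\<^sub>F x in at_top. C \<le> (2 * x) ^ n * exp (b * (2 * x)) * measure M {x<..}"
      using lower[of 2] by auto
    from C(2) show ?thesis
    proof eventually_elim
      case (elim x)
      then have "measure M {x<..} \<noteq> 0" using C(1) by auto
      then show ?case using g(1)[of x] measure_nonneg[of M "{x<..}"] by linarith
    qed
  qed
  fix \<delta> :: real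
  {
    assume \<delta>: "\<delta> < 1"
    \<comment> \<open>\<open>s > b * \<delta>\<close> makes the limiting slope \<open>s / b\<close>
      exceed \<open>\<delta>\<close>; the maximum with 0 keeps \<open>s\<close> admissible for
      Chernoff.\<close>
    obtain s where s: "max 0 (b * \<delta>) < s" "s < b"
      using dense[of "max 0 (b * \<delta>)" b] b_pos \<delta> by auto
    define K where "K = (\<integral>y. exp (s * y) \<partial>M)"
    have "((\<lambda>x. (s * x - ln K) / (b * x)) \<longlongrightarrow> s / b) at_top"
      using b_pos s by real_asymp (simp add: divide_inverse)
    moreover have "\<delta> < s / b" using s b_pos by (simp add: field_simps)
    ultimately have "\<forall>\<^sub>F x in at_top. \<delta> < (s * x - ln K) / (b * x)" by (rule order_tendstoD)
    then show "\<forall>\<^sub>F x in at_top. \<delta> < ln (g x) / (- b * x)"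
      using g_pos eventually_gt_at_top[of 0]
    proof eventually_elim
      case (elim x)
      have le: "g x \<le> exp (- s * x) * K"
        using g(2)[of x] chernoff_bound[of s x] s by (auto simp: K_def)
      then have "K > 0" using elim(2) by (smt (verit) mult_nonneg_nonpos exp_ge_zero)
      have "ln (g x) \<le> ln (exp (- s * x) * K)" using le elim(2) by (intro ln_mono) auto
      also have "\<dots> = - s * x + ln K" using \<open>K > 0\<close> by (simp add: ln_mult)
      finally have "(s * x - ln K) / (b * x) \<le> - ln (g x) / (b * x)"
        using elim(3) b_pos by (intro divide_right_mono) auto
      then show ?case using elim(1) by simp
    qed
  }
  {
    assume \<delta>: "\<delta> > 1"
    obtain \<mu> where \<mu>: "1 < \<mu>" "\<mu> < \<delta>" using dense[OF \<delta>] by blast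
    obtain C where C: "C > 0"
      "\<forall>\<^sub>F x in at_top. C \<le> (\<mu> * x) ^ n * exp (b * (\<mu> * x)) * measure M {x<..}"
      using lower[OF \<mu>(1)] by blast
    \<comment> \<open>The logarithm of the polynomial factor and the constant are negligible against
      \<open>b * x\<close>, leaving \<open>\<mu> < \<delta>\<close>.\<close>
    have "((\<lambda>x. (b * \<mu> * x + real n * ln (\<mu> * x) - ln C) / (b * x)) \<longlongrightarrow> \<mu>) at_top"
      using b_pos \<mu> by real_asymp
    from order_tendstoD(2)[OF this \<mu>(2)] C(2) g_pos eventually_gt_at_top[of 0]
    show "\<forall>\<^sub>F x in at_top. ln (g x) / (- b * x) < \<delta>"
    proof eventually_elim
      case (elim x)
      have "C \<le> (\<mu> * x) ^ n * exp (b * (\<mu> * x)) * g x"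
        using elim(2,4) \<mu>(1) by (rule_tac order_trans[OF elim(2)]) (auto intro!: mult_left_mono g(1))
      then have "ln C \<le> ln ((\<mu> * x) ^ n * exp (b * (\<mu> * x)) * g x)"
        using C(1) by (intro ln_mono) auto
      also have "\<dots> = real n * ln (\<mu> * x) + b * \<mu> * x + ln (g x)"
        using elim(3,4) \<mu>(1) by (simp add: ln_mult ln_realpow)
      finally have "- ln (g x) / (b * x) \<le> (b * \<mu> * x + real n * ln (\<mu> * x) - ln C) / (b * x)"
        using elim(4) b_pos by (intro divide_right_mono) auto
      then show ?case using elim(1) by simp
    qed
  }
qed

end

section \<open>Passage from the abscissae to both tails\<close>

text \<open>The infimum and the supremum provide finite exponents \<open>s1 < s < s2\<close>, and
  \<open>exp (s * y)\<close> is at most the sum of the exponentials at \<open>s1\<close> and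
  \<open>s2\<close>.\<close>

lemma two_sided_exponential_momentsI:
  assumes "finite_borel_measure F" "q_star F = ereal q" "0 < q" "r_star F = ereal r" "0 < r"
  shows "two_sided_exponential_moments F (- q) r"
proof -
  interpret finite_borel_measure F by fact
  have "integrable F (\<lambda>y. exp (s * y))" if s: "- q < s" "s < r" for s
  proof -
    have "(INF s\<in>{s. mgf_ext F s < \<infinity>}. ereal s) < ereal s"
      using assms(2) s(1) unfolding q_star_def by (metis ereal_uminus_eq_reorder ereal_less(2) less_ereal.simps(1) uminus_ereal.simps(1))
    then obtain s1 where s1: "integrable F (\<lambda>y. exp (s1 * y))" "s1 < s"
      by (auto simp: INF_less_iff integrable_exp_iff)
    have "ereal s < (SUP s\<in>{s. mgf_ext F s < \<infinity>}. ereal s)"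
      using assms(4) s(2) unfolding r_star_def by simp
    then obtain s2 where s2: "integrable F (\<lambda>y. exp (s2 * y))" "s < s2"
      by (auto simp: less_SUP_iff integrable_exp_iff)
    show ?thesis
    proof (rule Bochner_Integration.integrable_bound)
      show "integrable F (\<lambda>y. exp (s1 * y) + exp (s2 * y))"
        using s1 s2 by (intro Bochner_Integration.integrable_add)
      have "exp (s * y) \<le> exp (s1 * y) + exp (s2 * y)" for y
      proof (cases "y \<ge> 0")
        case True
        then have "exp (s * y) \<le> exp (s2 * y)" using s2(2) by (simp add: mult_right_mono)
        then show ?thesis by (simp add: add_increasing)
      next
        case False
        then have "exp (s * y) \<le> exp (s1 * y)" using s1(2) by (simp add: mult_right_mono_neg)
        then show ?thesis by (simp add: add_increasing2)
      qed
      then show "AE y in F. norm (exp (s * y)) \<le> norm (exp (s1 * y) + exp (s2 * y))"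
        by (intro AE_I2) (simp add: add_nonneg_nonneg)
    qed (simp add: measurable_M_eq)
  qed
  then show ?thesis using assms by unfold_locales auto
qed

lemma (in two_sided_exponential_moments) two_sided_exponential_moments_reflect:
  "two_sided_exponential_moments (distr M borel uminus) (- b) (- a)"
proof -
  have meas [measurable]: "uminus \<in> M \<rightarrow>\<^sub>M borel" by (subst measurable_M_eq) simp
  interpret G: finite_measure "distr M borel uminus" by (rule finite_measure_distr) measurable
  show ?thesis
  proof unfold_locales
    fix s assume "- b < s" "s < - a"
    then have "integrable M (\<lambda>y. exp (- s * y))" by (intro integrable_exp) auto
    then show "integrable (distr M borel uminus) (\<lambda>y. exp (s * y))"
      by (subst integrable_distr_eq[OF meas]) auto
  qed (use a_neg b_pos in auto)
qed

theorem theorem7: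
  fixes F :: "real measure" and q r :: real
  assumes "finite_borel_measure F"
    and "q_star F = ereal q" and "0 < q"
    and "r_star F = ereal r" and "0 < r"
  shows "((\<exists>(n::nat) (\<rho>::real) l\<^sub>1. \<rho> > 0 \<and> slowly_varying l\<^sub>1 \<and>
            (\<lambda>s. (-1) ^ n * (deriv ^^ n) (mgf F) (- q + s))
              \<sim>[at_right 0] (\<lambda>s. s powr (- \<rho>) * l\<^sub>1 (1 / s)))
           \<longrightarrow> (\<lambda>x. ln (measure F {..- x})) \<sim>[at_top] (\<lambda>x::real. - q * x))
       \<and> ((\<exists>(n::nat) (\<rho>::real) l\<^sub>1. \<rho> > 0 \<and> slowly_varying l\<^sub>1 \<and>
            (\<lambda>s. (deriv ^^ n) (mgf F) (r - s))
              \<sim>[at_right 0] (\<lambda>s. s powr (- \<rho>) * l\<^sub>1 (1 / s)))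
           \<longrightarrow> (\<lambda>x. ln (measure F {x<..})) \<sim>[at_top] (\<lambda>x::real. - r * x))"
proof -
  interpret F: two_sided_exponential_moments F "- q" r
    using assms by (rule two_sided_exponential_momentsI)
  have meas [measurable]: "uminus \<in> F \<rightarrow>\<^sub>M borel" by (subst F.measurable_M_eq) simp
  interpret G: two_sided_exponential_moments "distr F borel uminus" "- r" q
    using F.two_sided_exponential_moments_reflect by simp
  \<comment> \<open>For these \<open>s\<close> both \<open>- q + s\<close> and \<open>r - s\<close>
    lie in \<open>(- q, r)\<close>, where the derivative formula holds.\<close>
  have near: "\<forall>\<^sub>F s in at_right 0. 0 < s \<and> s < q + r"
    using assms unfolding eventually_at_right_field by (auto intro!: exI[of _ "q + r"])
  have left: "(\<lambda>x. ln (measure F {..- x})) \<sim>[at_top] (\<lambda>x. - q * x)"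
    if "\<rho> > 0" "slowly_varying l"
      and equiv: "(\<lambda>s. (-1) ^ n * (deriv ^^ n) (mgf F) (- q + s))
              \<sim>[at_right 0] (\<lambda>s. s powr (- \<rho>) * l (1 / s))" for n \<rho> l
  proof -
    \<comment> \<open>The sign \<open>(-1) ^ n\<close> turns \<open>y ^ n\<close> into
      \<open>(- y) ^ n\<close>, which gives the transform of the reflected measure near its right
      end \<open>q\<close>.\<close>
    have ev: "\<forall>\<^sub>F s in at_right 0. (-1) ^ n * (deriv ^^ n) (mgf F) (- q + s)
        = (\<integral>y. y ^ n * exp ((q - s) * y) \<partial>distr F borel uminus)"
      using near
    proof eventually_elim
      case (elim s)
      then have "(-1) ^ n * (deriv ^^ n) (mgf F) (- q + s) = (\<integral>y. (-1) ^ n * (y ^ n * exp ((- q + s) * y)) \<partial>F)"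
        by (simp add: F.higher_deriv_mgf)
      also have "\<dots> = (\<integral>y. (- y) ^ n * exp ((q - s) * - y) \<partial>F)"
      proof (intro Bochner_Integration.integral_cong refl)
        fix y :: real
        show "(- 1) ^ n * (y ^ n * exp ((- q + s) * y)) = (- y) ^ n * exp ((q - s) * - y)"
          by (subst power_minus[of y]) (simp add: algebra_simps)
      qed
      finally show ?case by (simp add: integral_distr[OF meas])
    qed
    have "(\<lambda>s. \<integral>y. y ^ n * exp ((q - s) * y) \<partial>distr F borel uminus)
              \<sim>[at_right 0] (\<lambda>s. s powr (- \<rho>) * l (1 / s))"
      by (rule asymp_equiv_cong[THEN iffD1, OF ev always_eventually equiv]) simp
    \<comment> \<open>Reflection produces the closed half-line, so here \<open>g\<close> is the
      closed tail, the upper end of its allowed range.\<close>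
    moreover have "measure (distr F borel uminus) {x..} = measure F {..- x}" for x
    proof -
      have "uminus -` {x..} \<inter> space F = {..- x}" by (auto simp: F.space_M_UNIV)
      then show ?thesis by (simp add: measure_distr[OF meas])
    qed
    moreover have "measure (distr F borel uminus) {x<..} \<le> measure (distr F borel uminus) {x..}" for x
      by (intro G.finite_measure_mono) auto
    ultimately show ?thesis
      using G.ln_tail_asymp_equiv[OF that(1,2)] by simp
  qed
  have right: "(\<lambda>x. ln (measure F {x<..})) \<sim>[at_top] (\<lambda>x. - r * x)"
    if "\<rho> > 0" "slowly_varying l"
      and equiv: "(\<lambda>s. (deriv ^^ n) (mgf F) (r - s))
              \<sim>[at_right 0] (\<lambda>s. s powr (- \<rho>) * l (1 / s))" for n \<rho> l
  proof -
    have ev: "\<forall>\<^sub>F s in at_right 0. (deriv ^^ n) (mgf F) (r - s) = (\<integral>y. y ^ n * exp ((r - s) * y) \<partial>F)"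
      using near by eventually_elim (simp add: F.higher_deriv_mgf)
    have "(\<lambda>s. \<integral>y. y ^ n * exp ((r - s) * y) \<partial>F)
              \<sim>[at_right 0] (\<lambda>s. s powr (- \<rho>) * l (1 / s))"
      by (rule asymp_equiv_cong[THEN iffD1, OF ev always_eventually equiv]) simp
    moreover have "measure F {x<..} \<le> measure F {x..}" for x
      by (intro F.finite_measure_mono) auto
    ultimately show ?thesis
      using F.ln_tail_asymp_equiv[OF that(1,2)] by simp
  qed
  show ?thesis using left right by blast
qed

end
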